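(* Let $n\ge 1$ and let $M_n=\{p_1,\dots,p_n\}$ be the set of the first $n$ primes. For every $p_i\in M_n$ and every real number $x\ge 0$, $$f_{M_n}(x) = f_{M_n-p_i}(x) - f_{M_n-p_i}\!\left(\frac{x}{p_i}\right).$$
   Context: $p_i$ denotes the $i$-th prime number. $M_n-p_i$ denotes the set $M_n\setminus\{p_i\}$, i.e. all the primes in $M_n$ other than $p_i$. For a finite set $S$ of primes and a real number $x\ge 0$, $f_S(x)$ denotes the number of positive integers $\le x$ that are not divisible by any prime in $S$. *)

theory Defs
  imports Complex_Main "HOL-Library.Infinite_Set" "HOL-Computational_Algebra.Primes"
begin

(* Indices start at 1, so nth_prime 1 = 2. The library's enumerate starts at 0;
   nth_prime 0 is a junk value that is never used below. *)
definition nth_prime :: "nat \<Rightarrow> nat" where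
  "nth_prime i = enumerate {p. prime p} (i - 1)"

definition first_primes :: "nat \<Rightarrow> nat set" where
  "first_primes n = nth_prime ` {1..n}"

definition sieve_count :: "nat set \<Rightarrow> real \<Rightarrow> nat" where
  "sieve_count S x = card {k::nat. 0 < k \<and> real k \<le> x \<and> (\<forall>p\<in>S. \<not> p dvd k)}"

end

theory Submission
  imports Defs
begin

(* Among the k \<le> x with no prime factor in T, those divisible by the further prime p
   are exactly the numbers p * m, where m \<le> x / p has no prime factor in T. *)

text \<open>This is Legendre's recursion: adding p to the sieve by T discards exactly the surviving
  multiples of p, and division by p matches these with the survivors up to x / p.
  \<open>sieve_count_insert\<close> proves it for any set T of primes and any prime p outside T, as
  a sum because subtraction on naturals truncates.\<close>

lemma prime_nth_prime: "prime (nth_prime i)"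
  using enumerate_in_set[OF primes_infinite] unfolding nth_prime_def by auto

lemma sieve_count_insert:
  assumes p: "prime p" "p \<notin> T" and T: "\<And>q. q \<in> T \<Longrightarrow> prime q"
  shows "sieve_count T x = sieve_count (insert p T) x + sieve_count T (x / real p)"
proof -
  define sieved where
    "sieved S y = {k::nat. 0 < k \<and> real k \<le> y \<and> (\<forall>q\<in>S. \<not> q dvd k)}" for S y
  have fin: "finite (sieved S y)" for S y
    by (rule finite_subset[of _ "{..nat \<lfloor>y\<rfloor>}"]) (auto simp: sieved_def le_nat_floor)
  have p0: "p > 0"
    using p(1) by (rule prime_gt_0_nat)
  \<comment> \<open>By Euclid's lemma q divides p or m; the first would force q = p, contrary to
    \<open>p \<notin> T\<close>.\<close>
  have dvd: "q dvd p * m \<longleftrightarrow> q dvd m" if "q \<in> T" for q m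
    using that p T by (metis prime_dvd_mult_iff primes_dvd_imp_eq)
  have le: "real (p * m) \<le> x \<longleftrightarrow> real m \<le> x / real p" for m
    using p0 by (simp add: field_simps)
  have mult: "p * m \<in> sieved T x \<longleftrightarrow> m \<in> sieved T (x / real p)" for m
    unfolding sieved_def mem_Collect_eq le using dvd p0 by auto
  have "sieved T x = sieved (insert p T) x \<union> {k \<in> sieved T x. p dvd k}"
    by (auto simp: sieved_def)
  also have "{k \<in> sieved T x. p dvd k} = (\<lambda>m. p * m) ` sieved T (x / real p)"
    using mult by (auto elim!: dvdE)
  finally have split: "sieved T x = sieved (insert p T) x \<union> (\<lambda>m. p * m) ` sieved T (x / real p)" .
  have "card (sieved T x) =
      card (sieved (insert p T) x) + card ((\<lambda>m. p * m) ` sieved T (x / real p))"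
    \<comment> \<open>Disjoint: the image consists of multiples of p, which the sieve by
      \<open>insert p T\<close> excludes.\<close>
    by (subst split, rule card_Un_disjoint) (auto intro!: fin, auto simp: sieved_def)
  also have "card ((\<lambda>m. p * m) ` sieved T (x / real p)) = card (sieved T (x / real p))"
    using p0 by (intro card_image) (auto simp: inj_on_def)
  finally show ?thesis
    by (simp add: sieve_count_def sieved_def)
qed

theorem theorem8:
  fixes n i :: nat and x :: real
  assumes "n \<ge> 1" and "i \<in> {1..n}" and "x \<ge> 0"
  shows "int (sieve_count (first_primes n) x) =
    int (sieve_count (first_primes n - {nth_prime i}) x)
    - int (sieve_count (first_primes n - {nth_prime i}) (x / real (nth_prime i)))"
proof -
  \<comment> \<open>The bound on i puts \<open>nth_prime i\<close> in the set, so removing and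
    reinserting it changes nothing.\<close>
  have "insert (nth_prime i) (first_primes n - {nth_prime i}) = first_primes n"
    using assms(2) by (auto simp: first_primes_def)
  moreover have "prime q" if "q \<in> first_primes n - {nth_prime i}" for q
    using that prime_nth_prime by (auto simp: first_primes_def)
  ultimately show ?thesis
    using sieve_count_insert[OF prime_nth_prime, of i "first_primes n - {nth_prime i}" x] by simp
qed

end
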